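(* Let $\Gamma$ be a directed strongly regular graph with parameters $(n,k,t,\lambda,\mu)$ and $\bar\Gamma$ its complementary digraph. Suppose $\pi$ is a homogeneous partition of the common vertex set which is good both for $\Gamma$ and for $\bar\Gamma$. Then for every positive integer $j$, the $\pi$-joins $\Gamma^j_\pi$ and $\bar\Gamma^j_\pi$ have complementary parameter sets: if $\Gamma^j_\pi$ has parameter set $(N,K,T,\Lambda,M)$, then $\bar\Gamma^j_\pi$ has parameter set $(N,\,N-K-1,\,N-2K+T-1,\,N-2K+M-2,\,N-2K+\Lambda)$.
   Context: A directed strongly regular graph (DSRG) with parameters $(n,k,t,\lambda,\mu)$ is a loopless digraph on $n$ vertices whose adjacency matrix $A$ satisfies $AJ=JA=kJ$ and $A^2=tI+\lambda A+\mu(J-I-A)$. The complementary digraph $\bar\Gamma$ has adjacency matrix $J-I-A$ and is a DSRG with parameters $(n,n-k-1,n-2k+t-1,n-2k+\mu-2,n-2k+\lambda)$. A partition is homogeneous if all its cells have the same size. The $\pi$-join of $\Gamma$ in power $j$ (for a homogeneous partition $\pi=\{C_1,\dots,C_a\}$ and positive integer $j$) is the digraph $\Gamma^j_\pi$ with vertex set $V(\Gamma)\times\{0,1,\ldots,ja\}$ and the following arcs: $(u,r)\to(v,r)$ whenever $u\to v$ is an arc of $\Gamma$; and for every vertex $(u,r)$, every $i\in\{1,\ldots,a\}$ and every $m\in\{1,\ldots,j\}$, arcs from $(u,r)$ to all vertices $(v,r')$ with $v\in C_i$ and $r'\equiv r+(i-1)j+m \pmod{ja+1}$; no other arcs. A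 homogeneous partition $\pi$ is called good for $\Gamma$ if the $\pi$-join $\Gamma^1_\pi$ is a DSRG.
   Formalization: The digraph Γ is additionally assumed to be neither empty nor complete (0 < k < n−1); without this the claim fails, e.g. for the empty digraph on 3 vertices with three singleton cells, where the joins have valencies 3 and 5 instead of 3 and 8. *)

theory Defs
  imports
    "Graph_Theory.Pair_Digraph"
    "HOL-Library.Disjoint_Sets"
    "HOL-Number_Theory.Cong"
begin

text \<open>
  Square matrices indexed by a finite set \<open>V\<close> are functions of two arguments; only their
  entries at positions in \<open>V\<close> are meaningful, and all matrix equations are stated on \<open>V\<close>.
\<close>

type_synonym 'a mat = "'a \<Rightarrow> 'a \<Rightarrow> int"

definition mat_mul :: "'a set \<Rightarrow> 'a mat \<Rightarrow> 'a mat \<Rightarrow> 'a mat" where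
  "mat_mul V A B = (\<lambda>u v. \<Sum>w\<in>V. A u w * B w v)"

definition id_mat :: "'a mat" where
  "id_mat = (\<lambda>u v. if u = v then 1 else 0)"

definition all_ones_mat :: "'a mat" where
  "all_ones_mat = (\<lambda>u v. 1)"

definition adj_mat :: "'a pair_pre_digraph \<Rightarrow> 'a mat" where
  "adj_mat G = (\<lambda>u v. if (u, v) \<in> parcs G then 1 else 0)"

text \<open>
  The parameters are integers, so that expressions such as \<open>n - 2 * k + \<mu> - 2\<close> are not truncated.
  Empty and complete digraphs are not excluded here.
\<close>

definition dsrg :: "'a pair_pre_digraph \<Rightarrow> int \<Rightarrow> int \<Rightarrow> int \<Rightarrow> int \<Rightarrow> int \<Rightarrow> bool" where
  "dsrg G n k t l m \<longleftrightarrow>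
     pair_digraph G \<and> int (card (pverts G)) = n \<and>
     (let V = pverts G; A = adj_mat G; J = all_ones_mat; I = id_mat in
        \<forall>u\<in>V. \<forall>v\<in>V.
          mat_mul V A J u v = k * J u v \<and>
          mat_mul V J A u v = k * J u v \<and>
          mat_mul V A A u v = t * I u v + l * A u v + m * (J u v - I u v - A u v))"

definition complement_digraph :: "'a pair_pre_digraph \<Rightarrow> 'a pair_pre_digraph" where
  "complement_digraph G =
     \<lparr>pverts = pverts G,
      parcs = {(u, v). u \<in> pverts G \<and> v \<in> pverts G \<and> u \<noteq> v \<and> (u, v) \<notin> parcs G}\<rparr>"

text \<open>
  A partition \<open>{C 1, \<dots>, C a}\<close> of \<open>V\<close> into cells of equal size. It is given by its enumeration,
  because the arcs of the join below refer to the numbering of the cells.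
\<close>

definition homogeneous_partition :: "'a set \<Rightarrow> (nat \<Rightarrow> 'a set) \<Rightarrow> nat \<Rightarrow> bool" where
  "homogeneous_partition V C a \<longleftrightarrow>
     partition_on V (C ` {1..a}) \<and> inj_on C {1..a} \<and>
     (\<forall>i\<in>{1..a}. \<forall>i'\<in>{1..a}. card (C i) = card (C i'))"

definition pi_join :: "'a pair_pre_digraph \<Rightarrow> (nat \<Rightarrow> 'a set) \<Rightarrow> nat \<Rightarrow> nat
    \<Rightarrow> ('a \<times> nat) pair_pre_digraph" where
  "pi_join G C a j =
     \<lparr>pverts = pverts G \<times> {0..j * a},
      parcs =
        {((u, r), (v, r)) | u v r. r \<in> {0..j * a} \<and> (u, v) \<in> parcs G} \<union>
        {((u, r), (v, r')) | u v r r'.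
           u \<in> pverts G \<and> r \<in> {0..j * a} \<and> r' \<in> {0..j * a} \<and>
           (\<exists>i\<in>{1..a}. \<exists>m\<in>{1..j}.
              v \<in> C i \<and> [r' = r + (i - 1) * j + m] (mod (j * a + 1)))}\<rparr>"

definition good_partition :: "'a pair_pre_digraph \<Rightarrow> (nat \<Rightarrow> 'a set) \<Rightarrow> nat \<Rightarrow> bool" where
  "good_partition G C a \<longleftrightarrow>
     homogeneous_partition (pverts G) C a \<and>
     (\<exists>N K T L M. dsrg (pi_join G C a 1) N K T L M)"

end

theory Submission
  imports Defs
begin

text \<open>
  In the adjacency matrix of the \<open>\<pi>\<close>-join, the block at position \<open>(r, r')\<close> is the adjacency
  matrix \<open>A\<close> of \<open>\<Gamma>\<close> if \<open>r = r'\<close>, and otherwise all its rows are the indicator vector of one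
  cell \<open>C\<^sub>i\<close>, where \<open>i\<close> depends only on \<open>r' - r\<close> modulo \<open>ja + 1\<close>, and each \<open>i\<close> arises
  from \<open>j\<close> differences. Squaring this matrix blockwise, with \<open>s\<close> the size of the cells, shows
  that the join is a DSRG if and only if every vertex \<open>v\<close> has exactly \<open>\<lambda> - k + s\<close> in-neighbours
  in its own cell and \<open>\<mu>\<close> in each other cell. This does not depend on \<open>j\<close>, and the parameters
  are then \<open>(n(ja + 1), k + jn, t + sj, \<lambda> + sj, \<mu> + sj)\<close>.

  Those of the two joins are complementary if and only if \<open>a = 2\<close>. If \<open>\<Gamma>\<close> and its complement
  both satisfy the condition, counting in the own cell of a vertex gives \<open>s = 2k - \<lambda> - \<mu>\<close>, and
  counting in another cell gives \<open>s = n - 2k + \<lambda> + \<mu>\<close>, so \<open>n = 2s\<close> and \<open>a = 2\<close> whenever there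
  is another cell. With a single cell one would get \<open>\<mu> = 0\<close> and \<open>t = k(n - k) > k\<close>, which is
  impossible.
\<close>

section \<open>Cyclic differences between layers and the cells they select\<close>

definition cyclic_diff :: "nat \<Rightarrow> nat \<Rightarrow> nat \<Rightarrow> nat" where
  "cyclic_diff p r r' = (if r \<le> r' then r' - r else r' + p - r)"

text \<open>Since \<open>r + d < 2 * p\<close>, reduction modulo \<open>p\<close> subtracts
  \<open>p\<close> at most once, which gives the two branches of \<open>cyclic_diff\<close>. The
  bounds on \<open>d\<close> rule out \<open>r = r'\<close>.\<close>

lemma cong_add_iff_cyclic_diff:
  assumes "r < p" "r' < p" "0 < d" "d < p"
  shows "[r' = r + d] (mod p) \<longleftrightarrow> r \<noteq> r' \<and> cyclic_diff p r r' = d"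
proof (cases "r + d < p")
  case True
  then show ?thesis using assms by (auto simp: cong_def cyclic_diff_def)
next
  case False
  then have "(r + d) mod p = r + d - p" using assms by (simp add: mod_if)
  then show ?thesis using assms False by (auto simp: cong_def cyclic_diff_def)
qed

text \<open>The nonzero differences \<open>1..j * a\<close> are cut into \<open>a\<close>
  consecutive runs of length \<open>j\<close>; the value is the number of the run, counted from 1.
  At \<open>r = r'\<close> truncation makes it a meaningless 1.\<close>

definition block :: "nat \<Rightarrow> nat \<Rightarrow> nat \<Rightarrow> nat \<Rightarrow> nat" where
  "block a j r r' = Suc ((cyclic_diff (j * a + 1) r r' - 1) div j)"

lemma cyclic_diff_bounds:
  assumes "r < p" "r' < p" "r \<noteq> r'"
  shows "0 < cyclic_diff p r r'" "cyclic_diff p r r' < p"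
  using assms by (auto simp: cyclic_diff_def)

text \<open>Dividing \<open>D - 1\<close> leaves a remainder in \<open>0..j - 1\<close>, and adding
  1 to it gives the \<open>m\<close> in \<open>1..j\<close> that occurs in the arcs of the
  join.\<close>

lemma Suc_div_eq_iff:
  fixes D :: nat
  assumes "0 < D" "0 < j" "0 < i"
  shows "Suc ((D - 1) div j) = i \<longleftrightarrow> (\<exists>m\<in>{1..j}. D = (i - 1) * j + m)"
proof
  assume "Suc ((D - 1) div j) = i"
  then have "(D - 1) = (i - 1) * j + (D - 1) mod j" by auto
  moreover have "(D - 1) mod j < j" using assms by simp
  ultimately show "\<exists>m\<in>{1..j}. D = (i - 1) * j + m"
    using assms by (intro bexI[of _ "Suc ((D - 1) mod j)"]) (auto simp: Suc_le_eq)
next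
  assume "\<exists>m\<in>{1..j}. D = (i - 1) * j + m"
  then obtain m where m: "1 \<le> m" "m \<le> j" "D = (i - 1) * j + m" by auto
  obtain m' where "m = Suc m'" using m(1) by (cases m) auto
  then have "(D - 1) div j = i - 1" using m by simp
  then show "Suc ((D - 1) div j) = i" using assms by simp
qed

lemma block_in:
  assumes "r \<in> {0..j * a}" "r' \<in> {0..j * a}" "r \<noteq> r'"
  shows "block a j r r' \<in> {1..a}"
proof -
  have "cyclic_diff (j * a + 1) r r' - 1 < a * j"
    using cyclic_diff_bounds[of r "j * a + 1" r'] assms by (auto simp: mult.commute)
  then have "(cyclic_diff (j * a + 1) r r' - 1) div j < a" by (simp add: less_mult_imp_div_less)
  then show ?thesis by (simp add: block_def)
qed

lemma ex_cong_iff_block: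
  assumes "r \<in> {0..j * a}" "r' \<in> {0..j * a}" "0 < j"
  shows "(\<exists>i\<in>{1..a}. \<exists>m\<in>{1..j}. v \<in> C i \<and> [r' = r + (i - 1) * j + m] (mod (j * a + 1)))
    \<longleftrightarrow> r \<noteq> r' \<and> v \<in> C (block a j r r')"
proof -
  let ?p = "j * a + 1"
  have eq: "(\<exists>m\<in>{1..j}. [r' = r + (i - 1) * j + m] (mod ?p)) \<longleftrightarrow> r \<noteq> r' \<and> block a j r r' = i"
    if i: "i \<in> {1..a}" for i
  proof -
    have "[r' = r + (i - 1) * j + m] (mod ?p) \<longleftrightarrow> r \<noteq> r' \<and> cyclic_diff ?p r r' = (i - 1) * j + m"
      if m: "m \<in> {1..j}" for m
    proof -
      \<comment> \<open>The offset is at most \<open>j * a\<close>, so it lies below the modulus and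
        the congruence fixes the cyclic difference itself.\<close>
      have "(i - 1) * j + m \<le> (i - 1) * j + j" using m by simp
      also have "\<dots> = i * j" using i by (cases i) auto
      also have "\<dots> \<le> j * a" using i by (simp add: mult.commute)
      finally show ?thesis
        using cong_add_iff_cyclic_diff[of r ?p r' "(i - 1) * j + m"] assms m
        by (auto simp: add.assoc)
    qed
    then have "(\<exists>m\<in>{1..j}. [r' = r + (i - 1) * j + m] (mod ?p)) \<longleftrightarrow>
        r \<noteq> r' \<and> (\<exists>m\<in>{1..j}. cyclic_diff ?p r r' = (i - 1) * j + m)" by blast
    also have "\<dots> \<longleftrightarrow> r \<noteq> r' \<and> block a j r r' = i"
      using Suc_div_eq_iff[of "cyclic_diff ?p r r'" j i] cyclic_diff_bounds[of r ?p r'] assms i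
      by (auto simp: block_def)
    finally show ?thesis .
  qed
  show ?thesis using eq block_in[OF assms(1,2)] by blast
qed

lemma card_block_eq:
  assumes "r' \<in> {0..j * a}" "0 < j" "i \<in> {1..a}"
  shows "card {r \<in> {0..j * a} - {r'}. block a j r r' = i} = j"
proof -
  let ?p = "j * a + 1"
  let ?S = "{r \<in> {0..j * a} - {r'}. block a j r r' = i}"
  let ?D = "{d \<in> {1..j * a}. Suc ((d - 1) div j) = i}"
  have "bij_betw (\<lambda>r. cyclic_diff ?p r r') ?S ?D"
    \<comment> \<open>For fixed \<open>r'\<close>, sending \<open>r\<close> to \<open>r' - r\<close>
      modulo \<open>p\<close> is an involution, so the same function serves as its inverse.\<close>
    by (rule bij_betw_byWitness[where f' = "\<lambda>d. cyclic_diff ?p d r'"])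
       (use assms in \<open>auto simp: cyclic_diff_def block_def split: if_splits\<close>)
  then have "card ?S = card ?D" by (rule bij_betw_same_card)
  also have "?D = (\<lambda>m. (i - 1) * j + m) ` {1..j}"
  proof -
    have le: "(i - 1) * j + m \<le> j * a" if "m \<le> j" for m
    proof -
      have "(i - 1) * j + m \<le> (i - 1) * j + j" using that by simp
      also have "\<dots> = i * j" using assms by (cases i) auto
      also have "\<dots> \<le> j * a" using assms by (simp add: mult.commute)
      finally show ?thesis .
    qed
    show ?thesis
    proof (intro set_eqI)
      fix d
      show "d \<in> ?D \<longleftrightarrow> d \<in> (\<lambda>m. (i - 1) * j + m) ` {1..j}"
      \<comment> \<open>\<open>Suc_div_eq_iff\<close> needs a positive argument; 0 lies in neither
        set.\<close>
      proof (cases "d = 0")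
        case False
        have "d \<in> ?D \<longleftrightarrow> d \<le> j * a \<and> (\<exists>m\<in>{1..j}. d = (i - 1) * j + m)"
          using Suc_div_eq_iff[of d j i] assms False by simp
        also have "\<dots> \<longleftrightarrow> (\<exists>m\<in>{1..j}. d = (i - 1) * j + m)"
          using le by (metis atLeastAtMost_iff)
        finally show ?thesis by blast
      qed simp
    qed
  qed
  also have "card \<dots> = j" by (subst card_image) (auto simp: inj_on_def)
  finally show ?thesis .
qed

section \<open>Cells of a homogeneous partition\<close>

lemma homogeneous_cell_subset:
  assumes "homogeneous_partition V C a" "i \<in> {1..a}"
  shows "C i \<subseteq> V"
  using assms unfolding homogeneous_partition_def partition_on_def by blast

text \<open>Distinct cells are disjoint, and injectivity of \<open>C\<close> makes cells with
  distinct indices distinct. The equivalence lets membership in a cell be replaced by an equation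
  between indices.\<close>

lemma homogeneous_cell_unique:
  assumes "homogeneous_partition V C a" "v \<in> V"
  obtains i where "i \<in> {1..a}" "\<And>i'. i' \<in> {1..a} \<Longrightarrow> v \<in> C i' \<longleftrightarrow> i' = i"
proof -
  have "v \<in> \<Union> (C ` {1..a})"
    using assms by (simp add: homogeneous_partition_def partition_on_def)
  then obtain i where i: "i \<in> {1..a}" "v \<in> C i" by blast
  have "i' = i" if "i' \<in> {1..a}" "v \<in> C i'" for i'
  proof (rule ccontr)
    assume "i' \<noteq> i"
    moreover have "inj_on C {1..a}" "disjoint (C ` {1..a})"
      using assms(1) by (simp_all add: homogeneous_partition_def partition_on_def)
    ultimately have "C i' \<inter> C i = {}"
      using that i by (metis disjointD image_eqI inj_onD)
    then show False using i that by blast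
  qed
  then show ?thesis using that i by blast
qed

lemma homogeneous_partition_card:
  assumes hp: "homogeneous_partition V C a" and fin: "finite V"
    and s: "\<And>i. i \<in> {1..a} \<Longrightarrow> card (C i) = s"
  shows "card V = a * s"
proof -
  have V: "V = (\<Union>i\<in>{1..a}. C i)"
    using hp by (simp add: homogeneous_partition_def partition_on_def)
  have "card (\<Union>i\<in>{1..a}. C i) = (\<Sum>i\<in>{1..a}. card (C i))"
  proof (rule card_UN_disjoint)
    show "\<forall>i\<in>{1..a}. finite (C i)"
      using homogeneous_cell_subset[OF hp] fin finite_subset by blast
    show "\<forall>i\<in>{1..a}. \<forall>i'\<in>{1..a}. i \<noteq> i' \<longrightarrow> C i \<inter> C i' = {}"
    proof (intro ballI impI equals0I)
      fix i i' v assume "i \<in> {1..a}" "i' \<in> {1..a}" "i \<noteq> i'" "v \<in> C i \<inter> C i'"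
      moreover from this have "v \<in> V" using V by blast
      ultimately show False using homogeneous_cell_unique[OF hp, of v] by (metis IntE)
    qed
  qed simp
  then show ?thesis using V s by simp
qed

text \<open>As \<open>v\<close> lies in exactly one cell \<open>C i\<close>, the sum counts the
  layers whose difference to \<open>r'\<close> falls into run \<open>i\<close>.\<close>

lemma sum_block_indicator:
  assumes "homogeneous_partition V C a" "v \<in> V" "r' \<in> {0..j * a}" "0 < j"
  shows "(\<Sum>r\<in>{0..j * a} - {r'}. of_bool (v \<in> C (block a j r r'))) = int j"
proof -
  obtain i where i: "i \<in> {1..a}" "\<And>i'. i' \<in> {1..a} \<Longrightarrow> v \<in> C i' \<longleftrightarrow> i' = i"
    using homogeneous_cell_unique[OF assms(1,2)] by blast
  have "(\<Sum>r\<in>{0..j * a} - {r'}. of_bool (v \<in> C (block a j r r')) :: int)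
      = (\<Sum>r\<in>{0..j * a} - {r'}. of_bool (block a j r r' = i))"
    using i block_in assms by (intro sum.cong) auto
  also have "\<dots> = int (card {r \<in> {0..j * a} - {r'}. block a j r r' = i})"
    by (simp add: Int_def)
  finally show ?thesis using card_block_eq[of r' j a i] assms i by simp
qed

section \<open>The join as a block matrix\<close>

lemma parcs_pi_join:
  assumes "pair_digraph G" "homogeneous_partition (pverts G) C a" "0 < j"
  shows "((u, r), (v, r')) \<in> parcs (pi_join G C a j) \<longleftrightarrow>
    u \<in> pverts G \<and> v \<in> pverts G \<and> r \<in> {0..j * a} \<and> r' \<in> {0..j * a} \<and>
    (if r = r' then (u, v) \<in> parcs G else v \<in> C (block a j r r'))"
proof -
  interpret pair_digraph G by fact
  define P where "P r r' v \<longleftrightarrow>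
    (\<exists>i\<in>{1..a}. \<exists>m\<in>{1..j}. v \<in> C i \<and> [r' = r + (i - 1) * j + m] (mod (j * a + 1)))" for r r' v
  have P: "P r r' v \<longleftrightarrow> r \<noteq> r' \<and> v \<in> C (block a j r r')"
    if "r \<in> {0..j * a}" "r' \<in> {0..j * a}"
    unfolding P_def by (rule ex_cong_iff_block[OF that \<open>0 < j\<close>])
  have "((u, r), (v, r')) \<in> parcs (pi_join G C a j) \<longleftrightarrow>
      (r = r' \<and> r \<in> {0..j * a} \<and> (u, v) \<in> parcs G) \<or>
      (u \<in> pverts G \<and> r \<in> {0..j * a} \<and> r' \<in> {0..j * a} \<and> P r r' v)"
    unfolding pi_join_def pair_pre_digraph.simps P_def[symmetric] by blast
  also have "\<dots> \<longleftrightarrow> u \<in> pverts G \<and> v \<in> pverts G \<and> r \<in> {0..j * a} \<and> r' \<in> {0..j * a} \<and>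
    (if r = r' then (u, v) \<in> parcs G else v \<in> C (block a j r r'))"
    using P in_arcsD1 in_arcsD2 block_in[of r j a r']
      homogeneous_cell_subset[OF assms(2), of "block a j r r'"]
    by (simp del: atLeastAtMost_iff split del: if_split split: if_split) blast
  finally show ?thesis .
qed

lemma adj_mat_pi_join:
  assumes "pair_digraph G" "homogeneous_partition (pverts G) C a" "0 < j"
    "r \<in> {0..j * a}" "r' \<in> {0..j * a}" "u \<in> pverts G" "v \<in> pverts G"
  shows "adj_mat (pi_join G C a j) (u, r) (v, r') =
    (if r = r' then adj_mat G u v else of_bool (v \<in> C (block a j r r')))"
  unfolding adj_mat_def parcs_pi_join[OF assms(1-3)] using assms(4-) by simp

lemma pair_digraphI:
  assumes "finite (pverts G)" "parcs G \<subseteq> pverts G \<times> pverts G" "\<And>u. (u, u) \<notin> parcs G"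
  shows "pair_digraph G"
proof -
  have "finite (parcs G)" using assms(1,2) by (meson finite_SigmaI finite_subset)
  then show ?thesis using assms by unfold_locales auto
qed

text \<open>The added arcs all change the layer, so a loop of the join would be a loop of
  \<open>G\<close>.\<close>

lemma pair_digraph_pi_join:
  assumes "pair_digraph G" "homogeneous_partition (pverts G) C a" "0 < j"
  shows "pair_digraph (pi_join G C a j)"
proof (rule pair_digraphI)
  interpret pair_digraph G by fact
  have V: "pverts (pi_join G C a j) = pverts G \<times> {0..j * a}" by (simp add: pi_join_def)
  show "finite (pverts (pi_join G C a j))" unfolding V by simp
  show "parcs (pi_join G C a j) \<subseteq> pverts (pi_join G C a j) \<times> pverts (pi_join G C a j)"
    unfolding V using parcs_pi_join[OF assms] by auto
  show "(x, x) \<notin> parcs (pi_join G C a j)" for x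
    using parcs_pi_join[OF assms, of "fst x" "snd x" "fst x" "snd x"] no_loops by fastforce
qed

section \<open>Counting identities of a DSRG and its complement\<close>

locale dsrg_digraph =
  fixes G :: "'a pair_pre_digraph" and n k t l m :: int
  assumes G: "dsrg G n k t l m"
begin

lemma pair_digraph: "pair_digraph G"
  using G by (simp add: dsrg_def)

lemma finite_verts: "finite (pverts G)"
  using pair_digraph by (simp add: pair_digraph_def pair_fin_digraph.pair_finite_verts)

lemma card_verts: "int (card (pverts G)) = n"
  using G by (simp add: dsrg_def)

lemma sum_adj_row: "u \<in> pverts G \<Longrightarrow> (\<Sum>w\<in>pverts G. adj_mat G u w) = k"
  using G by (auto simp: dsrg_def Let_def mat_mul_def all_ones_mat_def)

lemma sum_adj_col: "v \<in> pverts G \<Longrightarrow> (\<Sum>w\<in>pverts G. adj_mat G w v) = k"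
  using G by (auto simp: dsrg_def Let_def mat_mul_def all_ones_mat_def)

lemma sum_adj_adj:
  assumes "u \<in> pverts G" "v \<in> pverts G"
  shows "(\<Sum>w\<in>pverts G. adj_mat G u w * adj_mat G w v) =
    t * of_bool (u = v) + l * adj_mat G u v + m * (1 - of_bool (u = v) - adj_mat G u v)"
  using G assms by (simp add: dsrg_def Let_def mat_mul_def all_ones_mat_def id_mat_def of_bool_def)

lemma adj_mat_diag: "adj_mat G u u = 0"
  using pair_loopfree_digraph.pair_no_loops[of G "(u, u)"] pair_digraph
  by (auto simp: pair_digraph_def adj_mat_def)

text \<open>Multiplication by the identity matrix from the left and from the right.\<close>

lemma sum_of_bool_mult:
  fixes f :: "'a \<Rightarrow> int"
  assumes "u \<in> pverts G"
  shows "(\<Sum>w\<in>pverts G. of_bool (u = w) * f w) = f u"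
    and "(\<Sum>w\<in>pverts G. f w * of_bool (w = u)) = f u"
  using assms finite_verts
  by (simp_all add: of_bool_def if_distrib[where f = "\<lambda>x. x * _"]
      if_distrib[where f = "\<lambda>x. _ * x"] cong: if_cong)

text \<open>Compare the row sums of both sides of the equation for the square of the adjacency
  matrix. This later excludes a partition with a single cell.\<close>

lemma degree_square:
  assumes "pverts G \<noteq> {}"
  shows "k * k = t + l * k + m * (n - 1 - k)"
proof -
  obtain u where u: "u \<in> pverts G" using assms by blast
  have "(\<Sum>v\<in>pverts G. \<Sum>w\<in>pverts G. adj_mat G u w * adj_mat G w v) =
      (\<Sum>w\<in>pverts G. adj_mat G u w * (\<Sum>v\<in>pverts G. adj_mat G w v))"
    by (subst sum.swap) (simp only: sum_distrib_left)
  also have "\<dots> = (\<Sum>w\<in>pverts G. adj_mat G u w * k)"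
    by (intro sum.cong) (simp_all add: sum_adj_row)
  also have "\<dots> = k * k" by (simp only: sum_distrib_right[symmetric] sum_adj_row[OF u])
  finally have "k * k = (\<Sum>v\<in>pverts G. \<Sum>w\<in>pverts G. adj_mat G u w * adj_mat G w v)" ..
  also have "\<dots> = (\<Sum>v\<in>pverts G. of_bool (u = v) * t + l * adj_mat G u v
      + (m - of_bool (u = v) * m - m * adj_mat G u v))"
    by (intro sum.cong refl, subst sum_adj_adj[OF u]) (simp_all add: algebra_simps)
  also have "\<dots> = t + l * k + (m * n - m - m * k)"
    by (simp only: sum.distrib sum_subtractf sum_of_bool_mult[OF u] sum_distrib_left[symmetric] sum_adj_row[OF u])
      (simp add: card_verts)
  finally show ?thesis by (simp add: algebra_simps)
qed

text \<open>A diagonal entry of the square counts the out-neighbours of \<open>u\<close> that also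
  send an arc back to \<open>u\<close>.\<close>

lemma t_le_k:
  assumes "pverts G \<noteq> {}"
  shows "t \<le> k"
proof -
  obtain u where u: "u \<in> pverts G" using assms by blast
  have "t = (\<Sum>w\<in>pverts G. adj_mat G u w * adj_mat G w u)"
    using sum_adj_adj[OF u u] adj_mat_diag[of u] by simp
  also have "\<dots> \<le> (\<Sum>w\<in>pverts G. adj_mat G u w)"
    by (intro sum_mono) (simp add: adj_mat_def)
  finally show ?thesis using sum_adj_row[OF u] by simp
qed

text \<open>Supplies a position at which the parameter \<open>L\<close> of a join can be read
  off.\<close>

lemma obtain_adjacent:
  assumes "0 < k" "k < n - 1"
  obtains u v where "u \<in> pverts G" "v \<in> pverts G" "u \<noteq> v" "adj_mat G u v = 1"
proof -
  obtain u where u: "u \<in> pverts G" using assms card_verts by fastforce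
  then obtain v where v: "v \<in> pverts G" "adj_mat G u v \<noteq> 0"
    using sum_adj_row[OF u] assms by (metis sum.neutral less_irrefl)
  then show ?thesis using that[of u v] u adj_mat_diag[of u] by (auto simp: adj_mat_def split: if_splits)
qed

text \<open>A vertex adjacent to all others would have out-degree at least \<open>n - 1\<close>. The
  pair is the position at which the parameter \<open>M\<close> of a join can be read off.\<close>

lemma obtain_nonadjacent:
  assumes "0 < k" "k < n - 1"
  obtains u v where "u \<in> pverts G" "v \<in> pverts G" "u \<noteq> v" "adj_mat G u v = 0"
proof -
  obtain u where u: "u \<in> pverts G" using assms card_verts by fastforce
  have "\<exists>v\<in>pverts G. u \<noteq> v \<and> adj_mat G u v = 0"
  proof (rule ccontr)
    assume "\<not> ?thesis"
    then have *: "adj_mat G u v = 1" if "v \<in> pverts G - {u}" for v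
      using that by (auto simp: adj_mat_def split: if_splits)
    have "int (card (pverts G)) = 1 + int (card (pverts G - {u}))"
      using card.remove[OF finite_verts u] by simp
    also have "\<dots> = 1 + (\<Sum>v\<in>pverts G - {u}. adj_mat G u v)"
      using * by simp
    also have "\<dots> \<le> 1 + (\<Sum>v\<in>pverts G. adj_mat G u v)"
      using finite_verts by (intro add_left_mono sum_mono2) (auto simp: adj_mat_def)
    finally show False using sum_adj_row[OF u] assms card_verts by simp
  qed
  then show ?thesis using that u by blast
qed

lemma adj_mat_complement:
  assumes "u \<in> pverts G" "v \<in> pverts G"
  shows "adj_mat (complement_digraph G) u v = 1 - of_bool (u = v) - adj_mat G u v"
  using assms adj_mat_diag[of u] by (auto simp: complement_digraph_def adj_mat_def)

lemma dsrg_complement: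
  "dsrg (complement_digraph G) n (n - k - 1) (n - 2 * k + t - 1) (n - 2 * k + m - 2) (n - 2 * k + l)"
proof -
  let ?V = "pverts G" and ?H = "complement_digraph G"
  have V: "pverts ?H = ?V" by (simp add: complement_digraph_def)
  have pdH: "pair_digraph ?H"
    by (rule pair_digraphI) (auto simp: complement_digraph_def finite_verts)
  have row: "(\<Sum>w\<in>?V. adj_mat ?H u w) = n - k - 1" if u: "u \<in> ?V" for u
  proof -
    have "(\<Sum>w\<in>?V. adj_mat ?H u w) = (\<Sum>w\<in>?V. 1 - of_bool (u = w) * 1 - adj_mat G u w)"
      using u by (intro sum.cong) (auto simp: adj_mat_complement)
    then show ?thesis
      by (simp only: sum_subtractf sum_of_bool_mult[OF u] sum_adj_row[OF u]) (simp add: card_verts)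
  qed
  have col: "(\<Sum>w\<in>?V. adj_mat ?H w v) = n - k - 1" if v: "v \<in> ?V" for v
  proof -
    have "(\<Sum>w\<in>?V. adj_mat ?H w v) = (\<Sum>w\<in>?V. 1 - 1 * of_bool (w = v) - adj_mat G w v)"
      using v by (intro sum.cong) (auto simp: adj_mat_complement)
    then show ?thesis
      by (simp only: sum_subtractf sum_of_bool_mult[OF v] sum_adj_col[OF v]) (simp add: card_verts)
  qed
  \<comment> \<open>With \<open>J * J = n * J\<close> and \<open>A * J = J * A = k * J\<close>, the
    square of \<open>J - I - A\<close> is
    \<open>(n - 2 * k - 2) * J + I + 2 * A + A * A\<close>.\<close>
  have sq: "(\<Sum>w\<in>?V. adj_mat ?H u w * adj_mat ?H w v) =
      n - 2 * k - 2 + of_bool (u = v) + 2 * adj_mat G u v +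
      (t * of_bool (u = v) + l * adj_mat G u v + m * (1 - of_bool (u = v) - adj_mat G u v))"
    if u: "u \<in> ?V" and v: "v \<in> ?V" for u v
  proof -
    \<comment> \<open>The left factor is expanded throughout, the right one only where it meets
      \<open>A\<close>; the product with \<open>J\<close> is then the column sum of the complement
      found above.\<close>
    have "(\<Sum>w\<in>?V. adj_mat ?H u w * adj_mat ?H w v) =
        (\<Sum>w\<in>?V. adj_mat ?H w v - of_bool (u = w) * adj_mat ?H w v
          - (adj_mat G u w - adj_mat G u w * of_bool (w = v) - adj_mat G u w * adj_mat G w v))"
    proof (intro sum.cong refl)
      fix w assume w: "w \<in> ?V"
      show "adj_mat ?H u w * adj_mat ?H w v = adj_mat ?H w v - of_bool (u = w) * adj_mat ?H w v
          - (adj_mat G u w - adj_mat G u w * of_bool (w = v) - adj_mat G u w * adj_mat G w v)"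
        unfolding adj_mat_complement[OF u w] adj_mat_complement[OF w v]
        by (simp only: algebra_simps)
    qed
    also have "\<dots> = n - k - 1 - adj_mat ?H u v
        - (k - adj_mat G u v - (\<Sum>w\<in>?V. adj_mat G u w * adj_mat G w v))"
      by (simp only: sum_subtractf sum_of_bool_mult[OF u] sum_of_bool_mult[OF v]
          sum_adj_row[OF u] col[OF v])
    finally show ?thesis using sum_adj_adj[OF u v] adj_mat_complement[OF u v] by simp
  qed
  show ?thesis
    unfolding dsrg_def Let_def V mat_mul_def all_ones_mat_def id_mat_def mult_1 mult_1_right
  proof (intro conjI ballI)
    fix u v assume u: "u \<in> ?V" and v: "v \<in> ?V"
    show "(\<Sum>w\<in>?V. adj_mat ?H u w) = n - k - 1" "(\<Sum>w\<in>?V. adj_mat ?H w v) = n - k - 1"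
      by (fact row[OF u], fact col[OF v])
    show "(\<Sum>w\<in>?V. adj_mat ?H u w * adj_mat ?H w v) =
        (n - 2 * k + t - 1) * (if u = v then 1 else 0) + (n - 2 * k + m - 2) * adj_mat ?H u v +
        (n - 2 * k + l) * (1 - (if u = v then 1 else 0) - adj_mat ?H u v)"
      unfolding sq[OF u v] adj_mat_complement[OF u v] by (auto simp: algebra_simps)
  qed (use pdH card_verts in simp_all)
qed
end

section \<open>Row sums, column sums and the square of the join\<close>

locale dsrg_with_partition = dsrg_digraph +
  fixes C :: "nat \<Rightarrow> 'a set" and a s :: nat
  assumes hp: "homogeneous_partition (pverts G) C a"
    and card_cell: "\<And>i. i \<in> {1..a} \<Longrightarrow> card (C i) = s"
begin

lemma n_eq: "n = int a * int s"
  using homogeneous_partition_card[OF hp finite_verts card_cell] card_verts by simp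

lemma sum_cell_indicator:
  assumes "i \<in> {1..a}"
  shows "(\<Sum>w\<in>pverts G. of_bool (w \<in> C i) * f w) = (\<Sum>w\<in>C i. f w :: int)"
proof -
  have "(\<Sum>w\<in>pverts G. of_bool (w \<in> C i) * f w) = (\<Sum>w\<in>pverts G. if w \<in> C i then f w else 0)"
    by (intro sum.cong) auto
  also have "\<dots> = sum f (pverts G \<inter> C i)"
    by (simp add: sum.inter_restrict[OF finite_verts])
  also have "pverts G \<inter> C i = C i" using homogeneous_cell_subset[OF hp assms] by blast
  finally show ?thesis .
qed

lemma sum_cell_card:
  assumes "i \<in> {1..a}"
  shows "(\<Sum>w\<in>pverts G. of_bool (w \<in> C i)) = int s"
  using sum_cell_indicator[OF assms, of "\<lambda>_. 1"] card_cell[OF assms] by simp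

context
  fixes j :: nat
  assumes j: "0 < j"
begin

abbreviation "join_adj \<equiv> adj_mat (pi_join G C a j)"

lemmas adj_join = adj_mat_pi_join[OF pair_digraph hp j]

text \<open>The diagonal block contributes \<open>k\<close>. In each of the \<open>j * a\<close>
  other blocks a row is the indicator of a cell and contributes \<open>s\<close>, and
  \<open>n = a * s\<close>.\<close>

lemma sum_join_row:
  assumes "u \<in> pverts G" "r \<in> {0..j * a}"
  shows "(\<Sum>x\<in>pverts G \<times> {0..j * a}. join_adj (u, r) x) = k + int j * n"
proof -
  have "(\<Sum>x\<in>pverts G \<times> {0..j * a}. join_adj (u, r) x) = (\<Sum>r'\<in>{0..j * a}. \<Sum>w\<in>pverts G. join_adj (u, r) (w, r'))"
    by (subst sum.swap) (simp add: sum.cartesian_product)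
  also have "\<dots> = (\<Sum>w\<in>pverts G. join_adj (u, r) (w, r)) +
      (\<Sum>r'\<in>{0..j * a} - {r}. \<Sum>w\<in>pverts G. join_adj (u, r) (w, r'))"
    using assms by (subst sum.remove[of _ r]) auto
  also have "(\<Sum>w\<in>pverts G. join_adj (u, r) (w, r)) = k"
    using sum_adj_row assms by (simp add: adj_join)
  also have "(\<Sum>r'\<in>{0..j * a} - {r}. \<Sum>w\<in>pverts G. join_adj (u, r) (w, r')) = (\<Sum>r'\<in>{0..j * a} - {r}. int s)"
  proof (intro sum.cong refl)
    fix r' assume r': "r' \<in> {0..j * a} - {r}"
    have "(\<Sum>w\<in>pverts G. join_adj (u, r) (w, r')) = (\<Sum>w\<in>pverts G. of_bool (w \<in> C (block a j r r')))"
      using assms r' by (intro sum.cong) (auto simp: adj_join)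
    also have "\<dots> = int s" using assms r' block_in by (intro sum_cell_card) auto
    finally show "(\<Sum>w\<in>pverts G. join_adj (u, r) (w, r')) = int s" .
  qed
  also have "\<dots> = int j * n" using assms n_eq by simp
  finally show ?thesis .
qed

text \<open>A column of an off-diagonal block is constant: it has \<open>n\<close> ones if
  \<open>v\<close> lies in the selected cell and none otherwise. The former happens for
  \<open>j\<close> layers.\<close>

lemma sum_join_col:
  assumes "v \<in> pverts G" "r' \<in> {0..j * a}"
  shows "(\<Sum>x\<in>pverts G \<times> {0..j * a}. join_adj x (v, r')) = k + int j * n"
proof -
  have "(\<Sum>x\<in>pverts G \<times> {0..j * a}. join_adj x (v, r')) = (\<Sum>r\<in>{0..j * a}. \<Sum>w\<in>pverts G. join_adj (w, r) (v, r'))"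
    by (subst sum.swap) (simp add: sum.cartesian_product)
  also have "\<dots> = (\<Sum>w\<in>pverts G. join_adj (w, r') (v, r')) +
      (\<Sum>r\<in>{0..j * a} - {r'}. \<Sum>w\<in>pverts G. join_adj (w, r) (v, r'))"
    using assms by (subst sum.remove[of _ r']) auto
  also have "(\<Sum>w\<in>pverts G. join_adj (w, r') (v, r')) = k"
    using sum_adj_col assms by (simp add: adj_join)
  also have "(\<Sum>r\<in>{0..j * a} - {r'}. \<Sum>w\<in>pverts G. join_adj (w, r) (v, r')) =
      (\<Sum>r\<in>{0..j * a} - {r'}. n * of_bool (v \<in> C (block a j r r')))"
    using assms card_verts by (intro sum.cong) (auto simp: adj_join)
  also have "\<dots> = int j * n"
    using sum_block_indicator[OF hp assms j] by (simp add: sum_distrib_left[symmetric])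
  finally show ?thesis .
qed

text \<open>Paths are sorted by their middle layer \<open>q\<close>. The layer \<open>r\<close>
  gives the square of \<open>adj_mat G\<close>; any other \<open>q\<close> gives \<open>s\<close>
  paths if \<open>v\<close> lies in the cell selected from \<open>q\<close> to \<open>r\<close>,
  which occurs \<open>j\<close> times.\<close>

lemma sum_join_join_same:
  assumes "u \<in> pverts G" "v \<in> pverts G" "r \<in> {0..j * a}"
  shows "(\<Sum>x\<in>pverts G \<times> {0..j * a}. join_adj (u, r) x * join_adj x (v, r)) =
    (\<Sum>w\<in>pverts G. adj_mat G u w * adj_mat G w v) + int s * int j"
proof -
  have "(\<Sum>x\<in>pverts G \<times> {0..j * a}. join_adj (u, r) x * join_adj x (v, r)) =
      (\<Sum>q\<in>{0..j * a}. \<Sum>w\<in>pverts G. join_adj (u, r) (w, q) * join_adj (w, q) (v, r))"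
    by (subst sum.swap) (simp add: sum.cartesian_product)
  also have "\<dots> = (\<Sum>w\<in>pverts G. join_adj (u, r) (w, r) * join_adj (w, r) (v, r)) +
      (\<Sum>q\<in>{0..j * a} - {r}. \<Sum>w\<in>pverts G. join_adj (u, r) (w, q) * join_adj (w, q) (v, r))"
    using assms by (subst sum.remove[of _ r]) auto
  also have "(\<Sum>w\<in>pverts G. join_adj (u, r) (w, r) * join_adj (w, r) (v, r)) =
      (\<Sum>w\<in>pverts G. adj_mat G u w * adj_mat G w v)"
    using assms by (simp add: adj_join)
  also have "(\<Sum>q\<in>{0..j * a} - {r}. \<Sum>w\<in>pverts G. join_adj (u, r) (w, q) * join_adj (w, q) (v, r)) =
      (\<Sum>q\<in>{0..j * a} - {r}. int s * of_bool (v \<in> C (block a j q r)))"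
  proof (intro sum.cong refl)
    fix q assume q: "q \<in> {0..j * a} - {r}"
    have "(\<Sum>w\<in>pverts G. join_adj (u, r) (w, q) * join_adj (w, q) (v, r)) =
        (\<Sum>w\<in>pverts G. of_bool (w \<in> C (block a j r q)) * of_bool (v \<in> C (block a j q r)))"
      using assms q by (intro sum.cong) (auto simp: adj_join)
    also have "\<dots> = (\<Sum>w\<in>pverts G. of_bool (w \<in> C (block a j r q))) * of_bool (v \<in> C (block a j q r))"
      by (simp only: sum_distrib_right)
    also have "(\<Sum>w\<in>pverts G. of_bool (w \<in> C (block a j r q))) = int s"
      using assms q block_in by (intro sum_cell_card) auto
    finally show "(\<Sum>w\<in>pverts G. join_adj (u, r) (w, q) * join_adj (w, q) (v, r)) =
        int s * of_bool (v \<in> C (block a j q r))" .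
  qed
  also have "\<dots> = int s * int j"
    using sum_block_indicator[OF hp assms(2,3) j] by (simp add: sum_distrib_left[symmetric])
  finally show ?thesis .
qed

text \<open>Middle layer \<open>r\<close> contributes \<open>k\<close> if \<open>v\<close> lies in
  \<open>C i\<close>, since any out-neighbour of \<open>u\<close> will do. Middle layer
  \<open>r'\<close> contributes the in-neighbours of \<open>v\<close> in \<open>C i\<close>. The
  remaining layers contribute \<open>s\<close> paths or none. Nothing here depends on
  \<open>u\<close>.\<close>

lemma sum_join_join_diff:
  assumes "u \<in> pverts G" "v \<in> pverts G" "r \<in> {0..j * a}" "r' \<in> {0..j * a}" "r \<noteq> r'"
  defines "i \<equiv> block a j r r'"
  shows "(\<Sum>x\<in>pverts G \<times> {0..j * a}. join_adj (u, r) x * join_adj x (v, r')) =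
    k * of_bool (v \<in> C i) + (\<Sum>w\<in>C i. adj_mat G w v) + int s * (int j - of_bool (v \<in> C i))"
proof -
  have i: "i \<in> {1..a}" using block_in assms by simp
  have "(\<Sum>x\<in>pverts G \<times> {0..j * a}. join_adj (u, r) x * join_adj x (v, r')) =
      (\<Sum>q\<in>{0..j * a}. \<Sum>w\<in>pverts G. join_adj (u, r) (w, q) * join_adj (w, q) (v, r'))"
    by (subst sum.swap) (simp add: sum.cartesian_product)
  also have "\<dots> = (\<Sum>w\<in>pverts G. join_adj (u, r) (w, r) * join_adj (w, r) (v, r')) +
      (\<Sum>q\<in>{0..j * a} - {r}. \<Sum>w\<in>pverts G. join_adj (u, r) (w, q) * join_adj (w, q) (v, r'))"
    using assms by (subst sum.remove[of _ r]) auto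
  also have "(\<Sum>q\<in>{0..j * a} - {r}. \<Sum>w\<in>pverts G. join_adj (u, r) (w, q) * join_adj (w, q) (v, r')) =
      (\<Sum>w\<in>pverts G. join_adj (u, r) (w, r') * join_adj (w, r') (v, r')) +
      (\<Sum>q\<in>{0..j * a} - {r} - {r'}. \<Sum>w\<in>pverts G. join_adj (u, r) (w, q) * join_adj (w, q) (v, r'))"
    using assms by (subst sum.remove[of _ r']) auto
  also have "(\<Sum>w\<in>pverts G. join_adj (u, r) (w, r) * join_adj (w, r) (v, r')) = k * of_bool (v \<in> C i)"
  proof -
    have "(\<Sum>w\<in>pverts G. join_adj (u, r) (w, r) * join_adj (w, r) (v, r')) =
        (\<Sum>w\<in>pverts G. adj_mat G u w * of_bool (v \<in> C i))"
      using assms by (intro sum.cong) (auto simp: adj_join)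
    then show ?thesis using sum_adj_row[OF assms(1)] by (simp only: sum_distrib_right[symmetric])
  qed
  also have "(\<Sum>w\<in>pverts G. join_adj (u, r) (w, r') * join_adj (w, r') (v, r')) = (\<Sum>w\<in>C i. adj_mat G w v)"
  proof -
    have "(\<Sum>w\<in>pverts G. join_adj (u, r) (w, r') * join_adj (w, r') (v, r')) =
        (\<Sum>w\<in>pverts G. of_bool (w \<in> C i) * adj_mat G w v)"
      using assms by (intro sum.cong) (auto simp: adj_join)
    then show ?thesis by (simp only: sum_cell_indicator[OF i])
  qed
  also have "(\<Sum>q\<in>{0..j * a} - {r} - {r'}. \<Sum>w\<in>pverts G. join_adj (u, r) (w, q) * join_adj (w, q) (v, r')) =
      (\<Sum>q\<in>{0..j * a} - {r} - {r'}. int s * of_bool (v \<in> C (block a j q r')))"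
  proof (intro sum.cong refl)
    fix q assume q: "q \<in> {0..j * a} - {r} - {r'}"
    have "(\<Sum>w\<in>pverts G. join_adj (u, r) (w, q) * join_adj (w, q) (v, r')) =
        (\<Sum>w\<in>pverts G. of_bool (w \<in> C (block a j r q)) * of_bool (v \<in> C (block a j q r')))"
      using assms q by (intro sum.cong) (auto simp: adj_join)
    also have "\<dots> = (\<Sum>w\<in>pverts G. of_bool (w \<in> C (block a j r q))) * of_bool (v \<in> C (block a j q r'))"
      by (simp only: sum_distrib_right)
    also have "(\<Sum>w\<in>pverts G. of_bool (w \<in> C (block a j r q))) = int s"
      using assms q block_in by (intro sum_cell_card) auto
    finally show "(\<Sum>w\<in>pverts G. join_adj (u, r) (w, q) * join_adj (w, q) (v, r')) =
        int s * of_bool (v \<in> C (block a j q r'))" .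
  qed
  also have "\<dots> = int s * (int j - of_bool (v \<in> C i))"
  proof -
    \<comment> \<open>The layer \<open>r\<close>, already split off, is one of the \<open>j\<close>
      layers counted by \<open>sum_block_indicator\<close> exactly when \<open>v\<close> lies in
      \<open>C i\<close>.\<close>
    have "(\<Sum>q\<in>{0..j * a} - {r'}. of_bool (v \<in> C (block a j q r')) :: int) =
        of_bool (v \<in> C i) + (\<Sum>q\<in>{0..j * a} - {r'} - {r}. of_bool (v \<in> C (block a j q r')))"
      unfolding i_def using assms by (intro sum.remove) auto
    moreover have "{0..j * a} - {r'} - {r} = {0..j * a} - {r} - {r'}" by blast
    ultimately have "(\<Sum>q\<in>{0..j * a} - {r} - {r'}. of_bool (v \<in> C (block a j q r'))) =
        int j - of_bool (v \<in> C i)"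
      using sum_block_indicator[OF hp assms(2,4) j] by simp
    then show ?thesis by (simp only: sum_distrib_left[symmetric])
  qed
  finally show ?thesis by simp
qed

text \<open>The block products turn the matrix equations into conditions on \<open>G\<close> and the
  cells. The equation for \<open>K\<close> stays under the quantifiers because without vertices the
  matrix equations say nothing.\<close>

lemma dsrg_pi_join_unfold:
  "dsrg (pi_join G C a j) N K T L M \<longleftrightarrow>
    N = n * (int j * int a + 1) \<and>
    (\<forall>u\<in>pverts G. \<forall>v\<in>pverts G. \<forall>r\<in>{0..j * a}. \<forall>r'\<in>{0..j * a}. K = k + int j * n \<and>
      (if r = r' then
        t * of_bool (u = v) + l * adj_mat G u v + m * (1 - of_bool (u = v) - adj_mat G u v) + int s * int j
        = T * of_bool (u = v) + L * adj_mat G u v + M * (1 - of_bool (u = v) - adj_mat G u v)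
      else
        k * of_bool (v \<in> C (block a j r r')) + (\<Sum>w\<in>C (block a j r r'). adj_mat G w v) +
          int s * (int j - of_bool (v \<in> C (block a j r r')))
        = L * of_bool (v \<in> C (block a j r r')) + M * (1 - of_bool (v \<in> C (block a j r r')))))"
proof -
  let ?V = "pverts G \<times> {0..j * a}"
  have V: "pverts (pi_join G C a j) = ?V" by (simp add: pi_join_def)
  have N: "int (card ?V) = n * (int j * int a + 1)"
    using card_verts by (simp add: card_cartesian_product algebra_simps)
  have entry: "mat_mul ?V join_adj all_ones_mat (u, r) (v, r') = K * all_ones_mat (u, r) (v, r') \<and>
      mat_mul ?V all_ones_mat join_adj (u, r) (v, r') = K * all_ones_mat (u, r) (v, r') \<and>
      mat_mul ?V join_adj join_adj (u, r) (v, r') = T * id_mat (u, r) (v, r') + L * join_adj (u, r) (v, r')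
        + M * (all_ones_mat (u, r) (v, r') - id_mat (u, r) (v, r') - join_adj (u, r) (v, r')) \<longleftrightarrow>
      K = k + int j * n \<and>
      (if r = r' then
        t * of_bool (u = v) + l * adj_mat G u v + m * (1 - of_bool (u = v) - adj_mat G u v) + int s * int j
        = T * of_bool (u = v) + L * adj_mat G u v + M * (1 - of_bool (u = v) - adj_mat G u v)
      else
        k * of_bool (v \<in> C (block a j r r')) + (\<Sum>w\<in>C (block a j r r'). adj_mat G w v) +
          int s * (int j - of_bool (v \<in> C (block a j r r')))
        = L * of_bool (v \<in> C (block a j r r')) + M * (1 - of_bool (v \<in> C (block a j r r'))))"
    if "u \<in> pverts G" "v \<in> pverts G" "r \<in> {0..j * a}" "r' \<in> {0..j * a}" for u v r r'
  proof -
    have row: "mat_mul ?V join_adj all_ones_mat (u, r) (v, r') = k + int j * n"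
      using sum_join_row that by (simp add: mat_mul_def all_ones_mat_def)
    have col: "mat_mul ?V all_ones_mat join_adj (u, r) (v, r') = k + int j * n"
      using sum_join_col that by (simp add: mat_mul_def all_ones_mat_def)
    show ?thesis
    proof (cases "r = r'")
      case True
      have "mat_mul ?V join_adj join_adj (u, r) (v, r') =
          t * of_bool (u = v) + l * adj_mat G u v + m * (1 - of_bool (u = v) - adj_mat G u v) + int s * int j"
        unfolding mat_mul_def True[symmetric]
        using sum_join_join_same[OF that(1,2,3)] sum_adj_adj[OF that(1,2)] by (simp only:)
      then show ?thesis
        unfolding row col using True that
        by (auto simp: adj_join id_mat_def all_ones_mat_def)
    next
      case False
      show ?thesis
        unfolding row col unfolding mat_mul_def sum_join_join_diff[OF that False]
        using False that by (auto simp: adj_join id_mat_def all_ones_mat_def)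
    qed
  qed
  have split: "(\<forall>x\<in>?V. \<forall>y\<in>?V. P x y) \<longleftrightarrow> (\<forall>u\<in>pverts G. \<forall>v\<in>pverts G.
      \<forall>r\<in>{0..j * a}. \<forall>r'\<in>{0..j * a}. P (u, r) (v, r'))" for P by blast
  show ?thesis
    unfolding dsrg_def Let_def V N split
    by (simp only: entry pair_digraph_pi_join[OF pair_digraph hp j] simp_thms
        eq_commute[of "n * (int j * int a + 1)" N] cong: ball_cong)
qed

end

section \<open>Characterising the joins that are DSRGs\<close>

definition cell_regular :: bool where
  "cell_regular \<longleftrightarrow> (\<forall>v\<in>pverts G. \<forall>i\<in>{1..a}.
    (\<Sum>w\<in>C i. adj_mat G w v) = (if v \<in> C i then l - k + int s else m))"

text \<open>Diagonal blocks determine \<open>T\<close>, \<open>L\<close> and \<open>M\<close>. For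
  an in-neighbour count \<open>x\<close>, off-diagonal blocks then give
  \<open>k + x + s * (j - 1) = l + s * j\<close> in the own cell of a vertex and
  \<open>x + s * j = m + s * j\<close> elsewhere, so \<open>j\<close> cancels.\<close>

lemma dsrg_pi_join_iff:
  assumes k: "0 < k" "k < n - 1" and j: "0 < j"
  shows "dsrg (pi_join G C a j) N K T L M \<longleftrightarrow>
    N = n * (int j * int a + 1) \<and> K = k + int j * n \<and> T = t + int s * int j \<and>
    L = l + int s * int j \<and> M = m + int s * int j \<and> cell_regular"
    (is "?lhs \<longleftrightarrow> ?rhs")
proof
  assume ?lhs
  note D = this[unfolded dsrg_pi_join_unfold[OF j]]
  from obtain_adjacent[OF k] obtain u v
    where uv: "u \<in> pverts G" "v \<in> pverts G" "u \<noteq> v" "adj_mat G u v = 1" .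
  from obtain_nonadjacent[OF k] obtain u' v'
    where uv': "u' \<in> pverts G" "v' \<in> pverts G" "u' \<noteq> v'" "adj_mat G u' v' = 0" .
  have T: "T = t + int s * int j"
    using adj_mat_diag[of u] conjunct2[OF D, rule_format, of u u 0 0] uv by simp
  have L: "L = l + int s * int j"
    using conjunct2[OF D, rule_format, of u v 0 0] uv by simp
  have M: "M = m + int s * int j"
    using conjunct2[OF D, rule_format, of u' v' 0 0] uv' by simp
  have K: "K = k + int j * n"
    using conjunct2[OF D, rule_format, of u v 0 0] uv by simp
  have "cell_regular"
    unfolding cell_regular_def
  proof (intro ballI)
    fix x i assume x: "x \<in> pverts G" and i: "i \<in> {1..a}"
    \<comment> \<open>The first layer whose difference from layer 0 falls into run
      \<open>i\<close>.\<close>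
    let ?r' = "(i - 1) * j + 1"
    have "(i - 1) * j + 1 \<le> (i - 1) * j + j" using j by simp
    also have "\<dots> = i * j" using i by (cases i) auto
    also have "\<dots> \<le> j * a" using i by (simp add: mult.commute)
    finally have r': "?r' \<in> {0..j * a}" by simp
    have "block a j 0 ?r' = i"
      using i j by (simp add: block_def cyclic_diff_def)
    \<comment> \<open>An off-diagonal condition does not depend on the row, so the vertex
      \<open>u\<close> found above serves as one.\<close>
    then show "(\<Sum>w\<in>C i. adj_mat G w x) = (if x \<in> C i then l - k + int s else m)"
      using conjunct2[OF conjunct2[OF D, rule_format, of u x 0 ?r']] uv x r' L M
      by (auto simp: algebra_simps)
  qed
  then show ?rhs using D T L M K by blast
next
  assume R: ?rhs
  then have reg: "(\<Sum>w\<in>C i. adj_mat G w v) = (if v \<in> C i then l - k + int s else m)"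
    if "v \<in> pverts G" "i \<in> {1..a}" for v i using that by (simp add: cell_regular_def)
  show ?lhs
    unfolding dsrg_pi_join_unfold[OF j]
    using R block_in by (auto simp: reg algebra_simps simp del: atLeastAtMost_iff)
qed

lemma dsrg_complement_with_partition:
  "dsrg_with_partition (complement_digraph G) n (n - k - 1) (n - 2 * k + t - 1)
    (n - 2 * k + m - 2) (n - 2 * k + l) C a s"
  using dsrg_complement hp card_cell
  by unfold_locales (simp_all add: complement_digraph_def)

section \<open>Regularity on both sides forces two cells\<close>

lemma two_cells_if_both_regular:
  assumes k: "0 < k" "k < n - 1"
    and reg: "cell_regular"
    and reg': "dsrg_with_partition.cell_regular (complement_digraph G) (n - k - 1)
      (n - 2 * k + m - 2) (n - 2 * k + l) C a s"
  shows "a = 2"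
proof -
  let ?H = "complement_digraph G"
  interpret H: dsrg_with_partition ?H n "n - k - 1" "n - 2 * k + t - 1"
    "n - 2 * k + m - 2" "n - 2 * k + l" C a s
    by (rule dsrg_complement_with_partition)
  have V: "pverts ?H = pverts G" by (simp add: complement_digraph_def)
  have "0 < int a * int s" using k n_eq by simp
  then have pos: "0 < a" "0 < s" by (auto simp: zero_less_mult_iff)
  then have "card (C 1) \<noteq> 0" using card_cell by simp
  then obtain v where v: "v \<in> C 1" by (metis card.empty ex_in_conv)
  then have vV: "v \<in> pverts G" using homogeneous_cell_subset[OF hp, of 1] pos by auto
  have compl: "(\<Sum>w\<in>C i. adj_mat ?H w v) = int s - of_bool (v \<in> C i) - (\<Sum>w\<in>C i. adj_mat G w v)"
    if i: "i \<in> {1..a}" for i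
  proof -
    have sub: "C i \<subseteq> pverts G" using homogeneous_cell_subset[OF hp i] .
    have "(\<Sum>w\<in>C i. adj_mat ?H w v) = (\<Sum>w\<in>C i. 1 - of_bool (w = v) - adj_mat G w v)"
      using sub vV by (intro sum.cong) (auto simp: adj_mat_complement)
    also have "\<dots> = int (card (C i)) - (\<Sum>w\<in>C i. of_bool (w = v)) - (\<Sum>w\<in>C i. adj_mat G w v)"
      by (simp only: sum_subtractf) simp
    also have "(\<Sum>w\<in>C i. of_bool (w = v)) = (of_bool (v \<in> C i) :: int)"
      using finite_subset[OF sub finite_verts] by (simp add: of_bool_def)
    finally show ?thesis using card_cell[OF i] by simp
  qed
  \<comment> \<open>In its own cell \<open>v\<close> has \<open>s - 1\<close> possible
    in-neighbours, divided between \<open>G\<close> and the complement: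
    \<open>(l - k + s) + (m - k - 1 + s) = s - 1\<close>.\<close>
  have eq1: "int s = 2 * k - l - m"
    using compl[of 1] reg reg' v vV pos
    by (simp add: cell_regular_def H.cell_regular_def V)
  show ?thesis
  proof (cases "a = 1")
    case True
    have "C 1 = pverts G"
      using hp True by (simp add: homogeneous_partition_def partition_on_def)
    \<comment> \<open>All in-neighbours of \<open>v\<close> lie in the only cell, whose size is
      \<open>n\<close>.\<close>
    then have "k = l - k + int s"
      using reg[unfolded cell_regular_def, rule_format, of v 1] v vV True sum_adj_col[OF vV] by simp
    then have "m = 0" "l = 2 * k - n" using eq1 n_eq True by auto
    moreover have ne: "pverts G \<noteq> {}" using vV by blast
    ultimately have "k * k = t + (2 * k - n) * k" using degree_square by simp
    then have "t = k * (n - k)" by (simp add: algebra_simps)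
    \<comment> \<open>From \<open>k < n - 1\<close> follows \<open>n - k \<ge> 2\<close>, so
      \<open>t\<close> would be at least \<open>2 * k\<close>, against
      \<open>t_le_k\<close>.\<close>
    moreover have "k * 2 \<le> k * (n - k)" using k by (intro mult_left_mono) auto
    ultimately show ?thesis using t_le_k[OF ne] k by simp
  next
    case False
    then have 2: "1 \<in> {1..a}" "2 \<in> {1..a}" using pos by auto
    have "v \<notin> C 2"
      using homogeneous_cell_unique[OF hp vV] v 2 by (metis numeral_eq_one_iff semiring_norm(85))
    \<comment> \<open>In a foreign cell all \<open>s\<close> vertices are divided between the two
      digraphs, as \<open>m\<close> and \<open>n - 2 * k + l\<close>.\<close>
    then have "int s = n - 2 * k + l + m"
      using compl[OF 2(2)] reg reg' vV 2
      by (simp add: cell_regular_def H.cell_regular_def V)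
    then have "int a * int s = 2 * int s" using eq1 n_eq by simp
    then show ?thesis using pos by simp
  qed
qed

end

section \<open>Comparing the parameters of the two joins\<close>

theorem theorem4:
  fixes G :: "'a pair_pre_digraph"
    and n k t l m :: int
    and C :: "nat \<Rightarrow> 'a set"
    and a j :: nat
  assumes "dsrg G n k t l m"
    and "0 < k" and "k < n - 1"
    and "homogeneous_partition (pverts G) C a"
    and "good_partition G C a"
    and "good_partition (complement_digraph G) C a"
    and "j \<ge> 1"
  shows "(\<exists>N K T L M. dsrg (pi_join G C a j) N K T L M) \<and>
    (\<forall>N K T L M. dsrg (pi_join G C a j) N K T L M \<longrightarrow>
       dsrg (pi_join (complement_digraph G) C a j)
         N (N - K - 1) (N - 2 * K + T - 1) (N - 2 * K + M - 2) (N - 2 * K + L))"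
proof -
  let ?H = "complement_digraph G"
  define s where "s = card (C 1)"
  have cell: "card (C i) = s" if "i \<in> {1..a}" for i
    using assms(4) that unfolding homogeneous_partition_def s_def
    by (metis atLeastAtMost_iff le_trans order_refl)
  interpret dsrg_with_partition G n k t l m C a s
    using assms(1,4) cell by unfold_locales
  interpret H: dsrg_with_partition ?H n "n - k - 1" "n - 2 * k + t - 1"
    "n - 2 * k + m - 2" "n - 2 * k + l" C a s
    by (rule dsrg_complement_with_partition)
  have j: "0 < j" using assms(7) by simp
  have k': "0 < n - k - 1" "n - k - 1 < n - 1" using assms(2,3) by auto
  note iff = dsrg_pi_join_iff[OF assms(2,3)] and iff' = H.dsrg_pi_join_iff[OF k']
  \<comment> \<open>Goodness is the case \<open>j = 1\<close> of the two equivalences; the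
    regularity conditions do not mention \<open>j\<close> and so carry over to the given
    power.\<close>
  have reg: cell_regular and reg': H.cell_regular
    using assms(5,6) iff[of 1] iff'[of 1] by (auto simp: good_partition_def)
  have "a = 2" using two_cells_if_both_regular[OF assms(2,3) reg reg'] .
  \<comment> \<open>For \<open>a = 2\<close>, \<open>N - 2 * K = n - 2 * k\<close> and
    \<open>N - K - 1 = (n - k - 1) + j * n\<close>, while the other three parameters grow by
    \<open>s * j\<close> in both joins.\<close>
  then show ?thesis
    unfolding iff[OF j] iff'[OF j] using reg reg' by (auto simp: algebra_simps)
qed

end
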